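(* Every simple edge-colored graph on $n$ vertices with at least $n$ color classes, each containing at least $0.3988\,n$ edges, contains a rainbow triangle.
   Context: An edge-coloring of a graph $G$ is an arbitrary map $f:E(G)\to\mathbb{N}$ (not necessarily proper); for a color $i$, the set $f^{-1}(i)$ is the color class of $i$. A rainbow triangle is a triangle in $G$ whose three edges have pairwise distinct colors. A graph is simple if it has no loops or parallel edges. (In the paper's terminology, $(1,0.3988)$ is "triangular", where $(\alpha,\beta)$ is triangular if every simple edge-colored graph on $n$ vertices with at least $\alpha n$ color classes, each with at least $\beta n$ edges, has a rainbow triangle.) *)

theory Defs
  imports Complex_Main
begin

(* Edges are two-element vertex sets, which excludes both loops and parallel edges. *)
definition simple_graph :: "'a set \<Rightarrow> 'a set set \<Rightarrow> bool" where
  "simple_graph V E \<longleftrightarrow> finite V \<and> (\<forall>e\<in>E. e \<subseteq> V \<and> card e = 2)"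

(* An edge-coloring is an arbitrary f :: 'a set => nat; only its values on E matter. *)
definition color_class :: "'a set set \<Rightarrow> ('a set \<Rightarrow> nat) \<Rightarrow> nat \<Rightarrow> 'a set set" where
  "color_class E f i = {e \<in> E. f e = i}"

definition triangle :: "'a set set \<Rightarrow> 'a \<Rightarrow> 'a \<Rightarrow> 'a \<Rightarrow> bool" where
  "triangle E x y z \<longleftrightarrow> distinct [x, y, z] \<and> {x, y} \<in> E \<and> {y, z} \<in> E \<and> {x, z} \<in> E"

definition rainbow_triangle :: "'a set set \<Rightarrow> ('a set \<Rightarrow> nat) \<Rightarrow> 'a \<Rightarrow> 'a \<Rightarrow> 'a \<Rightarrow> bool" where
  "rainbow_triangle E f x y z \<longleftrightarrow>
     triangle E x y z \<and> distinct [f {x, y}, f {y, z}, f {x, z}]"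

end

(* Keep n colours with exactly k \<ge> 0.3988 n edges each, so m = n k. Without a rainbow triangle,
   every triangle contains a monochromatic cherry (path of length two), so the number t of
   triangles is at most the number of closed monochromatic cherries, which is at most n k^2 / 2.
   Conversely 3 t = 4 m^2 / n - n m + D, where D \<ge> 0 is the sum of the squared deviations of the
   degrees from 2 k and of the number of pairs (edge, vertex adjacent to neither end).
   With D \<ge> 0 alone this gives a contradiction for k \<ge> 0.4 n. For smaller k it still leaves
   D \<le> 0.0012 n^3, and forces some colour class to be nearly a star whose leaf set A, of size
   about 0.4 n, spans nearly a clique. As degrees are about 0.8 n, vertices outside A miss on
   average about 0.13 n vertices of A, hence most of the pairs among these, which are edges;
   this makes D exceed 0.003 n^3. *)

theory Submission
  imports Defs
begin

section \<open>Counting inequalities and their numerical consequence\<close>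

text \<open>Expanding the product, both mixed terms sum to the squared degrees. For an adjacency
  function the left side counts pairs of an ordered edge and a vertex adjacent to neither end, so it
  is nonnegative, and the identity bounds the triangle count from below in terms of degrees.\<close>

lemma sum_induced_edge_isolated_vertex:
  fixes a :: "'a \<Rightarrow> 'a \<Rightarrow> real"
  assumes "\<And>u v. a u v = a v u"
  shows "(\<Sum>u\<in>V. \<Sum>v\<in>V. \<Sum>w\<in>V. a u v * (1 - a u w) * (1 - a v w)) =
    (\<Sum>u\<in>V. \<Sum>v\<in>V. \<Sum>w\<in>V. a u v * a u w * a v w)
    - 2 * (\<Sum>u\<in>V. (\<Sum>v\<in>V. a u v)\<^sup>2) + real (card V) * (\<Sum>u\<in>V. \<Sum>v\<in>V. a u v)"
proof -
  have "(\<Sum>u\<in>V. \<Sum>v\<in>V. \<Sum>w\<in>V. a u v * (1 - a u w) * (1 - a v w)) =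
    (\<Sum>u\<in>V. \<Sum>v\<in>V. \<Sum>w\<in>V. a u v * a u w * a v w)
    - (\<Sum>u\<in>V. \<Sum>v\<in>V. \<Sum>w\<in>V. a u v * a u w)
    - (\<Sum>u\<in>V. \<Sum>v\<in>V. \<Sum>w\<in>V. a u v * a v w) + (\<Sum>u\<in>V. \<Sum>v\<in>V. \<Sum>w\<in>V. a u v)"
    unfolding sum.distrib[symmetric] sum_subtractf[symmetric]
    by (intro sum.cong refl) (simp add: algebra_simps)
  moreover have "(\<Sum>u\<in>V. \<Sum>v\<in>V. \<Sum>w\<in>V. a u v * a u w) = (\<Sum>u\<in>V. (\<Sum>v\<in>V. a u v)\<^sup>2)"
    by (simp add: power2_eq_square sum_product)
  moreover have "(\<Sum>u\<in>V. \<Sum>v\<in>V. \<Sum>w\<in>V. a u v * a v w) = (\<Sum>u\<in>V. (\<Sum>v\<in>V. a u v)\<^sup>2)"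
    by (subst sum.swap) (simp add: power2_eq_square sum_product assms)
  moreover have "(\<Sum>u\<in>V. \<Sum>v\<in>V. \<Sum>w\<in>V. a u v) = real (card V) * (\<Sum>u\<in>V. \<Sum>v\<in>V. a u v)"
    by (simp add: sum_distrib_left)
  ultimately show ?thesis
    by simp
qed

text \<open>Every edge at \<open>u\<close> is counted once more at its other end, which differs from
  \<open>u\<close>. Thus a degree is at most the number of edges.\<close>

lemma double_degree_le_sum_degrees:
  fixes b :: "'a \<Rightarrow> 'a \<Rightarrow> real"
  assumes V: "finite V" "u \<in> V"
    and sym: "\<And>u v. b u v = b v u" and irr: "b u u = 0" and nonneg: "\<And>u v. b u v \<ge> 0"
  shows "2 * (\<Sum>v\<in>V. b u v) \<le> (\<Sum>x\<in>V. \<Sum>v\<in>V. b x v)"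
proof -
  have "(\<Sum>v\<in>V. b u v) = (\<Sum>x\<in>V - {u}. b u x)"
    using V irr by (simp add: sum.remove[of V u])
  also have "\<dots> = (\<Sum>x\<in>V - {u}. b x u)"
    by (intro sum.cong refl sym)
  also have "\<dots> \<le> (\<Sum>x\<in>V - {u}. \<Sum>v\<in>V. b x v)"
    using V by (intro sum_mono member_le_sum) (auto simp: nonneg)
  finally show ?thesis
    using V by (simp add: sum.remove[of V u "\<lambda>x. \<Sum>v\<in>V. b x v"])
qed

text \<open>Treat every pair of distinct neighbours of \<open>u\<close> as closed. Pairs with
  \<open>v = w\<close> contribute nothing because \<open>a v v = 0\<close>; this saves the linear
  term.\<close>

lemma sum_closed_cherries_le:
  fixes a b :: "'a \<Rightarrow> 'a \<Rightarrow> real"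
  assumes b01: "\<And>u v. b u v \<in> {0, 1}" and a1: "\<And>u v. a u v \<le> 1" and a_irr: "\<And>u. a u u = 0"
    and V: "finite V"
  shows "(\<Sum>v\<in>V. \<Sum>w\<in>V. b u v * b u w * a v w) \<le> (\<Sum>v\<in>V. b u v)\<^sup>2 - (\<Sum>v\<in>V. b u v)"
proof -
  have "(\<Sum>v\<in>V. \<Sum>w\<in>V. b u v * b u w * a v w) \<le>
      (\<Sum>v\<in>V. \<Sum>w\<in>V. b u v * b u w - (if w = v then b u v else 0))"
  proof (intro sum_mono)
    fix v w
    show "b u v * b u w * a v w \<le> b u v * b u w - (if w = v then b u v else 0)"
      using b01[of u v] b01[of u w] a1[of v w] a_irr[of v] by auto
  qed
  also have "\<dots> = (\<Sum>v\<in>V. b u v)\<^sup>2 - (\<Sum>v\<in>V. b u v)"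
    using V by (simp add: sum_subtractf power2_eq_square sum_product)
  finally show ?thesis .
qed

text \<open>\<open>A\<close> is the neighbourhood of a vertex \<open>c\<close> of maximum degree in
  the colour class \<open>b\<close>. Bounding all degrees by \<open>card A\<close> gives the first
  estimate. For the second, cherries centred at \<open>c\<close> are closed exactly by adjacent
  pairs inside \<open>A\<close>, and all others are few because only \<open>k - card A\<close> edges
  avoid \<open>c\<close>.\<close>

lemma closed_cherries_le_near_star:
  fixes a b :: "'a \<Rightarrow> 'a \<Rightarrow> real"
  assumes V: "finite V" "V \<noteq> {}"
    and b01: "\<And>u v. b u v \<in> {0, 1}" and b_sym: "\<And>u v. b u v = b v u" and b_irr: "\<And>u. b u u = 0"
    and a1: "\<And>u v. a u v \<le> 1" and a_irr: "\<And>u. a u u = 0"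
    and size: "(\<Sum>u\<in>V. \<Sum>v\<in>V. b u v) = 2 * k"
    and C: "C = (\<Sum>u\<in>V. \<Sum>v\<in>V. \<Sum>w\<in>V. b u v * b u w * a v w)"
  obtains A where "A \<subseteq> V" "real (card A) \<le> k" "C \<le> 2 * k * (real (card A) - 1)"
    "C \<le> (\<Sum>u\<in>A. \<Sum>v\<in>A. a u v) + 2 * (k - real (card A))\<^sup>2 + 2 * (k - real (card A))"
proof -
  define f where "f u = (\<Sum>v\<in>V. b u v)" for u
  have b_nonneg: "b u v \<ge> 0" for u v
    using b01[of u v] by auto
  obtain c where c: "c \<in> V" and max: "\<And>u. u \<in> V \<Longrightarrow> f u \<le> f c"
    using V Max_in[of "f ` V"] by (metis (no_types, lifting) Max_ge empty_is_image finite_imageI image_iff)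
  define A where "A = {v \<in> V. b c v = 1}"
  have b_c: "b c v = (if v \<in> A then 1 else 0)" if "v \<in> V" for v
    using b01[of c v] that by (auto simp: A_def)
  have A: "finite A" "A \<subseteq> V"
    using V by (auto simp: A_def)
  have restr: "(\<Sum>v\<in>V. b c v * h v) = (\<Sum>v\<in>A. h v)" for h
  proof -
    have "(\<Sum>v\<in>V. b c v * h v) = (\<Sum>v\<in>V. if v \<in> A then h v else 0)"
      by (intro sum.cong) (auto simp: b_c)
    also have "\<dots> = (\<Sum>v\<in>V \<inter> A. h v)"
      using V by (simp add: sum.inter_restrict)
    finally show ?thesis
      using A by (simp add: Int_absorb1)
  qed
  have fc: "f c = real (card A)"
    using restr[of "\<lambda>_. 1"] by (simp add: f_def)
  define s where "s = real (card A)"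
  define V' where "V' = V - {c}"
  define g where "g u = (\<Sum>v\<in>V'. b u v)" for u
  have V': "finite V'"
    using V by (simp add: V'_def)
  have f_g: "f u = b u c + g u" for u
    using sum.remove[OF V(1) c, of "b u"] by (simp add: f_def g_def V'_def)
  \<comment> \<open>The edges at \<open>c\<close> are counted once at \<open>c\<close> and once at
    their other ends, so deleting \<open>c\<close> lowers the degree sum by
    \<open>2 * s\<close>.\<close>
  have "2 * k = f c + (\<Sum>u\<in>V'. f u)"
    using size sum.remove[OF V(1) c, of f] by (simp add: f_def V'_def)
  also have "(\<Sum>u\<in>V'. f u) = (\<Sum>u\<in>V'. b c u) + (\<Sum>u\<in>V'. g u)"
    by (simp add: f_g sum.distrib b_sym[of _ c])
  also have "(\<Sum>u\<in>V'. b c u) = f c"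
    using f_g[of c] by (simp add: b_irr g_def)
  finally have sum_g: "(\<Sum>u\<in>V'. g u) = 2 * (k - s)"
    by (simp add: fc s_def)
  have g_nonneg: "g u \<ge> 0" for u
    by (simp add: g_def sum_nonneg b_nonneg)
  have r_nonneg: "0 \<le> k - s"
    using sum_g sum_nonneg[of V' g] g_nonneg by simp
  have g_le: "g u \<le> k - s" if "u \<in> V'" for u
  proof -
    have "2 * g u \<le> (\<Sum>x\<in>V'. g x)"
      unfolding g_def by (rule double_degree_le_sum_degrees) (use V' that b_sym b_irr b_nonneg in auto)
    then show ?thesis
      using sum_g by simp
  qed
  have "C \<le> (\<Sum>u\<in>V. (f u)\<^sup>2 - f u)"
    unfolding C f_def by (intro sum_mono sum_closed_cherries_le b01 a1 a_irr V)
  also have "\<dots> \<le> (\<Sum>u\<in>V. f u * (s - 1))"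
  proof (intro sum_mono)
    fix u assume "u \<in> V"
    then have "f u * f u \<le> f u * s"
      using max[of u] by (intro mult_left_mono) (simp_all add: fc s_def, simp add: f_def sum_nonneg b_nonneg)
    then show "(f u)\<^sup>2 - f u \<le> f u * (s - 1)"
      by (simp add: power2_eq_square algebra_simps)
  qed
  also have "\<dots> = 2 * k * (s - 1)"
    using size by (simp add: sum_distrib_right[symmetric] f_def)
  finally have C1: "C \<le> 2 * k * (s - 1)" .
  have "(\<Sum>u\<in>V'. \<Sum>v\<in>V. \<Sum>w\<in>V. b u v * b u w * a v w) \<le> (\<Sum>u\<in>V'. (f u)\<^sup>2 - f u)"
    unfolding f_def by (intro sum_mono sum_closed_cherries_le b01 a1 a_irr V)
  also have "\<dots> \<le> (\<Sum>u\<in>V'. g u * (k - s + 1))"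
  proof (intro sum_mono)
    fix u assume "u \<in> V'"
    then have "g u * g u \<le> g u * (k - s)"
      using g_le g_nonneg by (intro mult_left_mono) auto
    \<comment> \<open>If \<open>u\<close> is adjacent to \<open>c\<close>, then
      \<open>f u = g u + 1\<close> and equality holds; otherwise \<open>f u = g u\<close>.\<close>
    moreover have "(f u)\<^sup>2 - f u \<le> g u * g u + g u"
      using b01[of u c] g_nonneg[of u] by (auto simp: f_g power2_eq_square algebra_simps)
    ultimately show "(f u)\<^sup>2 - f u \<le> g u * (k - s + 1)"
      by (simp add: algebra_simps)
  qed
  also have "\<dots> = 2 * (k - s)\<^sup>2 + 2 * (k - s)"
    by (simp only: sum_distrib_right[symmetric] sum_g) (simp add: power2_eq_square algebra_simps)
  finally have rest: "(\<Sum>u\<in>V'. \<Sum>v\<in>V. \<Sum>w\<in>V. b u v * b u w * a v w) \<le> 2 * (k - s)\<^sup>2 + 2 * (k - s)" .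
  have "(\<Sum>v\<in>V. \<Sum>w\<in>V. b c v * b c w * a v w) = (\<Sum>v\<in>A. \<Sum>w\<in>A. a v w)"
    by (simp add: restr sum_distrib_left[symmetric] mult.assoc)
  then have C2: "C \<le> (\<Sum>v\<in>A. \<Sum>w\<in>A. a v w) + 2 * (k - s)\<^sup>2 + 2 * (k - s)"
    using rest unfolding C V'_def by (simp add: sum.remove[OF V(1) c])
  show thesis
    using that[of A] A C1 C2 r_nonneg by (simp add: s_def)
qed

(* Squared numbers of non-neighbours in A are bounded below by the tangent at \<mu>, squared degree
   deviations by the tangent at \<mu> / 2; with this choice the degree sum over A cancels. *)
lemma sum_induced_edge_isolated_vertex_ge:
  fixes a :: "'a \<Rightarrow> 'a \<Rightarrow> real"
  assumes V: "finite V" "A \<subseteq> V"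
    and a01: "\<And>u v. a u v \<in> {0, 1}" and a_sym: "\<And>u v. a u v = a v u"
    and s: "s = real (card A)" and n: "n = real (card V)"
    and M: "M = s\<^sup>2 - (\<Sum>u\<in>A. \<Sum>v\<in>A. a u v)"
  shows "2 * \<mu> * (s * n - M - s * \<Delta>) - \<mu>\<^sup>2 * s / 2 - (n - s) * (\<mu>\<^sup>2 + M) \<le>
    2 * (\<Sum>u\<in>V. ((\<Sum>v\<in>V. a u v) - \<Delta>)\<^sup>2)
    + (\<Sum>u\<in>V. \<Sum>v\<in>V. \<Sum>w\<in>V. a u v * (1 - a u w) * (1 - a v w))"
proof -
  have A: "finite A"
    using V finite_subset by blast
  define d where "d u = (\<Sum>v\<in>V. a u v)" for u
  define z where "z w = (\<Sum>u\<in>A. 1 - a u w)" for w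
  have nonneg: "a u v * (1 - a u w) * (1 - a v w) \<ge> 0" for u v w
    using a01[of u v] a01[of u w] a01[of v w] by auto
  have M': "M = (\<Sum>u\<in>A. \<Sum>v\<in>A. 1 - a u v)"
    by (simp add: M sum_subtractf s power2_eq_square)
  have card_diff: "real (card (V - A)) = n - s"
    using V A by (simp add: n s card_Diff_subset of_nat_diff card_mono)
  \<comment> \<open>\<open>z w\<close> is the number of vertices of \<open>A\<close> not adjacent to
    \<open>w\<close>. Of the \<open>(z w)\<^sup>2\<close> ordered pairs of such vertices at most
    \<open>M\<close> are non-adjacent; each of the others is an edge with \<open>w\<close> adjacent
    to neither end.\<close>
  have "(\<Sum>w\<in>V - A. (z w)\<^sup>2 - M) \<le>
      (\<Sum>w\<in>V - A. \<Sum>u\<in>A. \<Sum>v\<in>A. a u v * (1 - a u w) * (1 - a v w))"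
  proof (intro sum_mono)
    fix w
    have "(z w)\<^sup>2 - M = (\<Sum>u\<in>A. \<Sum>v\<in>A. (1 - a u w) * (1 - a v w) - (1 - a u v))"
      unfolding M' z_def power2_eq_square sum_product by (simp only: sum_subtractf)
    also have "\<dots> \<le> (\<Sum>u\<in>A. \<Sum>v\<in>A. a u v * (1 - a u w) * (1 - a v w))"
    proof (intro sum_mono)
      fix u v
      show "(1 - a u w) * (1 - a v w) - (1 - a u v) \<le> a u v * (1 - a u w) * (1 - a v w)"
        using a01[of u v] a01[of u w] a01[of v w] by auto
    qed
    finally show "(z w)\<^sup>2 - M \<le> (\<Sum>u\<in>A. \<Sum>v\<in>A. a u v * (1 - a u w) * (1 - a v w))" .
  qed
  also have "\<dots> \<le> (\<Sum>w\<in>V. \<Sum>u\<in>V. \<Sum>v\<in>V. a u v * (1 - a u w) * (1 - a v w))"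
  proof -
    have "(\<Sum>u\<in>A. \<Sum>v\<in>A. a u v * (1 - a u w) * (1 - a v w)) \<le>
        (\<Sum>u\<in>V. \<Sum>v\<in>V. a u v * (1 - a u w) * (1 - a v w))" for w
      using V by (intro order_trans[OF sum_mono sum_mono2] sum_mono2 sum_nonneg) (auto simp: nonneg)
    then show ?thesis
      using V by (intro order_trans[OF sum_mono sum_mono2] sum_nonneg) (auto simp: nonneg)
  qed
  also have "\<dots> = (\<Sum>u\<in>V. \<Sum>v\<in>V. \<Sum>w\<in>V. a u v * (1 - a u w) * (1 - a v w))"
    by (subst sum.swap) (intro sum.cong refl sum.swap)
  finally have Q: "(\<Sum>w\<in>V - A. (z w)\<^sup>2 - M) \<le>
    (\<Sum>u\<in>V. \<Sum>v\<in>V. \<Sum>w\<in>V. a u v * (1 - a u w) * (1 - a v w))" .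
  \<comment> \<open>Count the non-adjacent pairs between \<open>A\<close> and its complement: those
    in A x V, less the \<open>M\<close> inside \<open>A\<close>.\<close>
  have sum_z: "(\<Sum>w\<in>V - A. z w) = s * n - (\<Sum>u\<in>A. d u) - M"
  proof -
    have "(\<Sum>w\<in>V - A. z w) = (\<Sum>u\<in>A. \<Sum>w\<in>V - A. 1 - a u w)"
      unfolding z_def by (rule sum.swap)
    also have "\<dots> = (\<Sum>u\<in>A. (\<Sum>w\<in>V. 1 - a u w) - (\<Sum>w\<in>A. 1 - a u w))"
      using V by (simp add: sum_diff)
    also have "\<dots> = (\<Sum>u\<in>A. n - d u) - M"
      unfolding M' sum_subtractf[of _ _ A] by (simp add: d_def n sum_subtractf)
    finally show ?thesis
      by (simp add: sum_subtractf s)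
  qed
  have tangent: "2 * p * x - p\<^sup>2 \<le> x\<^sup>2" for p x :: real
    using zero_le_power2[of "x - p"] by (simp add: power2_diff algebra_simps)
  have "2 * \<mu> * (s * n - (\<Sum>u\<in>A. d u) - M) - (n - s) * (\<mu>\<^sup>2 + M) =
      (\<Sum>w\<in>V - A. 2 * \<mu> * z w - \<mu>\<^sup>2 - M)"
    by (simp only: sum_subtractf sum_distrib_left[symmetric] sum_z sum_constant card_diff)
      (simp add: algebra_simps)
  also have "\<dots> \<le> (\<Sum>w\<in>V - A. (z w)\<^sup>2 - M)"
    by (intro sum_mono diff_right_mono tangent)
  finally have Q': "2 * \<mu> * (s * n - (\<Sum>u\<in>A. d u) - M) - (n - s) * (\<mu>\<^sup>2 + M) \<le>
      (\<Sum>w\<in>V - A. (z w)\<^sup>2 - M)" .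
  have "\<mu> * ((\<Sum>u\<in>A. d u) - s * \<Delta>) - \<mu>\<^sup>2 * s / 4 = (\<Sum>u\<in>A. 2 * (\<mu> / 2) * (d u - \<Delta>) - (\<mu> / 2)\<^sup>2)"
    by (simp only: sum_subtractf sum_distrib_left[symmetric] sum_constant s)
      (simp add: algebra_simps power2_eq_square)
  also have "\<dots> \<le> (\<Sum>u\<in>A. (d u - \<Delta>)\<^sup>2)"
    by (intro sum_mono tangent)
  also have "\<dots> \<le> (\<Sum>u\<in>V. (d u - \<Delta>)\<^sup>2)"
    using V by (intro sum_mono2) auto
  finally have "\<mu> * ((\<Sum>u\<in>A. d u) - s * \<Delta>) - \<mu>\<^sup>2 * s / 4 \<le> (\<Sum>u\<in>V. (d u - \<Delta>)\<^sup>2)" .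
  then show ?thesis
    using Q Q' unfolding d_def[symmetric] by (simp add: algebra_simps)
qed

(* Counting ordered pairs doubles all quantities: C is twice the number of closed cherries, W is
   twice the excess D, and M counts the ordered non-adjacent pairs of A, diagonal included. *)
lemma near_star_parameters_contradiction:
  fixes n k s M C W :: real
  assumes n: "n > 0" and k: "k \<ge> 3988 / 10000 * n" and s: "s \<le> k" and M: "M \<ge> s"
    and avg: "n * (8 * k\<^sup>2 - 2 * n * k) + W \<le> 3 * n * C" and W: "W \<ge> 0"
    and C1: "C \<le> 2 * k * (s - 1)"
    and C2: "C \<le> s\<^sup>2 - M + 2 * (k - s)\<^sup>2 + 2 * (k - s)"
    and lower: "n / 5 * (s * n - M - s * (2 * k)) - (n / 10)\<^sup>2 * s / 2 - (n - s) * ((n / 10)\<^sup>2 + M) \<le> W"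
  shows False
proof -
  have k0: "k > 0"
    using n k by simp
  have "n * (8 * k\<^sup>2 - 2 * n * k) \<le> n * (3 * C)"
    using avg W by (simp add: algebra_simps)
  then have C: "8 * k\<^sup>2 - 2 * n * k \<le> 3 * C"
    using n by simp
  with C1 have "2 * k * (4 * k - n) \<le> 2 * k * (3 * (s - 1))"
    by (simp add: power2_eq_square algebra_simps)
  then have s_ge: "4 * k - n \<le> 3 * (s - 1)"
    using k0 by simp
  \<comment> \<open>For \<open>s = k\<close> the bound from \<open>C2\<close> is 3 k^2 - 3 M; the
    last product is the loss when \<open>s < k\<close>. The term 3 k^2 is split into the lower bound
    for 3 C and a remainder \<open>k * (2 * n - 5 * k)\<close>, which is positive only for k < 0.4
    n.\<close>
  have key: "3 * C \<le> 8 * k\<^sup>2 - 2 * n * k + k * (2 * n - 5 * k) - 3 * M - 3 * ((k - s) * (3 * s - k - 2))"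
    using C2 by (simp add: power2_eq_square algebra_simps)
  have "(k - s) * (3 * k - n) \<le> (k - s) * (3 * s - k - 2)"
    using s s_ge by (intro mult_left_mono) auto
  then have bd: "3 * M + 3 * ((k - s) * (3 * k - n)) \<le> k * (2 * n - 5 * k)"
    using key C by simp
  define p q where "p = (k - s) * n" and "q = k * (2 * n - 5 * k)"
  \<comment> \<open>0.1964 = 3 * 0.3988 - 1.\<close>
  have "(k - s) * (3 * k - n) \<ge> (k - s) * (1964 / 10000 * n)"
    using s k n by (intro mult_left_mono) auto
  then have "(k - s) * (3 * k - n) \<ge> 1964 / 10000 * p"
    by (simp add: p_def)
  with bd have bd': "3 * M + 5892 / 10000 * p \<le> q"
    unfolding q_def by linarith
  have s0: "s > 0"
    using s_ge k n by simp
  moreover have p_nonneg: "p \<ge> 0"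
    using s n by (simp add: p_def)
  ultimately have "q > 0"
    using bd' M by linarith
  then have k_le: "k \<le> 4 / 10 * n"
    using k0 by (simp add: q_def zero_less_mult_iff)
  \<comment> \<open>The second factor uses 2 - 5 * 0.3988 = 0.006.\<close>
  have "k * (2 * n - 5 * k) \<le> (4 / 10 * n) * (6 / 1000 * n)"
    using k k_le n by (intro mult_mono) auto
  then have small: "q \<le> 24 / 10000 * (n * n)"
    by (simp add: q_def)
  have M_le: "M \<le> 8 / 10000 * (n * n)"
    using bd' small p_nonneg by linarith
  have "5892 / 10000 * p \<le> 24 / 10000 * (n * n)"
    using bd' small M s0 by linarith
  then have "n * (5892 * (k - s)) \<le> n * (24 * n)"
    by (simp add: p_def algebra_simps)
  then have "5892 * (k - s) \<le> 24 * n"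
    using n by (simp only: mult_le_cancel_left_pos)
  \<comment> \<open>Here 0.3988 - 24 / 5892 is still above 0.394, so the colour class is nearly a
    star.\<close>
  then have s_ge': "s \<ge> 394 / 1000 * n"
    using k n by (simp add: field_simps)
  have "0 \<le> (k - s) * (3 * k - n)"
    using s k n by simp
  then have "3 * C - (8 * k\<^sup>2 - 2 * n * k) \<le> 24 / 10000 * (n * n)"
    using key small[unfolded q_def] M s0 \<open>(k - s) * (3 * k - n) \<le> (k - s) * (3 * s - k - 2)\<close> by linarith
  then have "n * (3 * C - (8 * k\<^sup>2 - 2 * n * k)) \<le> n * (24 / 10000 * (n * n))"
    using n by (intro mult_left_mono) auto
  then have W_le: "W \<le> 24 / 10000 * (n * n * n)"
    using avg by (simp add: algebra_simps)
  \<comment> \<open>The hypothesis \<open>lower\<close> reads X - Y / 2 - Z \<le> W. In units of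
    n^3, X is at least 0.0156, Y at most 0.004 and Z at most 0.00655, so W would exceed 0.007,
    against the upper bound 0.0024.\<close>
  define X Y Z where "X = n / 5 * (s * n - M - s * (2 * k))" and "Y = (n / 10)\<^sup>2 * s"
    and "Z = (n - s) * ((n / 10)\<^sup>2 + M)"
  have "(394 / 1000 * n) * (2 / 10 * n) \<le> s * (n - 2 * k)"
    using s_ge' k_le n by (intro mult_mono) auto
  then have "78 / 1000 * (n * n) \<le> s * n - M - s * (2 * k)"
    using M_le by (simp add: algebra_simps)
  then have "n / 5 * (78 / 1000 * (n * n)) \<le> X"
    unfolding X_def using n by (intro mult_left_mono) auto
  moreover have "Y \<le> (n / 10)\<^sup>2 * (4 / 10 * n)"
    unfolding Y_def using s k_le by (intro mult_left_mono) auto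
  moreover have "Z \<le> (606 / 1000 * n) * (108 / 10000 * (n * n))"
    unfolding Z_def using s s_ge' k_le n M s0 M_le by (intro mult_mono) (auto simp: power2_eq_square)
  moreover have "n * (n * n) > 0"
    using n by simp
  ultimately show False
    using lower W_le unfolding X_def[symmetric] Y_def[symmetric] Z_def[symmetric]
    by (simp add: power2_eq_square algebra_simps)
qed

section \<open>Application to the edge-colored graph\<close>

lemma sum_adjacency_eq_twice_card:
  assumes "finite V" and F: "\<And>e. e \<in> F \<Longrightarrow> e \<subseteq> V \<and> card e = 2" and "finite F"
  shows "(\<Sum>u\<in>V. \<Sum>v\<in>V. of_bool ({u, v} \<in> F)) = 2 * real (card F)"
proof -
  have "(\<Sum>u\<in>V. \<Sum>v\<in>V. of_bool ({u, v} \<in> F)) = (\<Sum>u\<in>V. \<Sum>v\<in>V. \<Sum>e\<in>F. of_bool ({u, v} = e) :: real)"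
    using \<open>finite F\<close> by (simp add: of_bool_def)
  also have "\<dots> = (\<Sum>e\<in>F. \<Sum>u\<in>V. \<Sum>v\<in>V. of_bool ({u, v} = e))"
    by (subst sum.swap[of _ F V]) (intro sum.cong refl sum.swap)
  also have "\<dots> = (\<Sum>e\<in>F. 2)"
  proof (intro sum.cong refl)
    fix e assume "e \<in> F"
    then obtain x y where e: "e = {x, y}" "x \<noteq> y" "x \<in> V" "y \<in> V"
      using F[of e] by (auto simp: card_2_iff)
    have "(\<Sum>u\<in>V. \<Sum>v\<in>V. of_bool ({u, v} = e)) =
        (\<Sum>u\<in>V. \<Sum>v\<in>V. (if v = y then of_bool (u = x) else 0) + (if v = x then of_bool (u = y) else 0) :: real)"
      using e by (intro sum.cong refl) (auto simp: doubleton_eq_iff)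
    also have "\<dots> = 2"
      using e \<open>finite V\<close> by (simp add: sum.distrib of_bool_def)
    finally show "(\<Sum>u\<in>V. \<Sum>v\<in>V. of_bool ({u, v} = e)) = (2 :: real)" .
  qed
  finally show ?thesis
    by simp
qed

theorem theorem1p5:
  fixes V :: "'a set" and E :: "'a set set" and f :: "'a set \<Rightarrow> nat" and n :: nat
  assumes "simple_graph V E"
    and "card V = n"
    and "n \<ge> 1"
    and "card {i. real (card (color_class E f i)) \<ge> 0.3988 * real n} \<ge> n"
  shows "\<exists>x y z. rainbow_triangle E f x y z"
proof (rule ccontr)
  assume no_rainbow: "\<nexists>x y z. rainbow_triangle E f x y z"
  have V: "finite V" "V \<noteq> {}" and E: "\<And>e. e \<in> E \<Longrightarrow> e \<subseteq> V \<and> card e = 2"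
    using assms by (auto simp: simple_graph_def)
  have "finite E"
    using V E by (meson Pow_iff finite_Pow_iff finite_subset subsetI)
  define k where "k = nat \<lceil>0.3988 * real n\<rceil>"
  obtain I where I: "card I = n" "finite I"
      "I \<subseteq> {i. real (card (color_class E f i)) \<ge> 0.3988 * real n}"
    using obtain_subset_with_card_n[OF assms(4)] by metis
  have "\<exists>F. F \<subseteq> color_class E f i \<and> card F = k" if "i \<in> I" for i
  proof -
    have "k \<le> card (color_class E f i)"
      using I that by (auto simp: k_def)
    then show ?thesis
      by (metis obtain_subset_with_card_n)
  qed
  then obtain F where F: "\<And>i. i \<in> I \<Longrightarrow> F i \<subseteq> color_class E f i" "\<And>i. i \<in> I \<Longrightarrow> card (F i) = k"
    by metis
  have FE: "e \<in> E" "f e = i" if "i \<in> I" "e \<in> F i" for e i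
    using F(1)[OF that(1)] that(2) by (auto simp: color_class_def)
  define b :: "nat \<Rightarrow> 'a \<Rightarrow> 'a \<Rightarrow> real" where "b i u v = of_bool ({u, v} \<in> F i)" for i u v
  define a where "a u v = (\<Sum>i\<in>I. b i u v)" for u v
  \<comment> \<open>An edge can lie in \<open>F i\<close> only for its own color \<open>i\<close>,
    so the sum over colors has at most one nonzero term and \<open>a\<close> is the adjacency
    function of the kept edges.\<close>
  have a_iff: "a u v = of_bool (f {u, v} \<in> I \<and> {u, v} \<in> F (f {u, v}))" for u v
  proof -
    have "a u v = (\<Sum>i\<in>I. if f {u, v} = i then b i u v else 0)"
      unfolding a_def by (intro sum.cong refl) (auto simp: b_def dest: FE)
    then show ?thesis
      using I by (auto simp: b_def)
  qed
  have b01: "b i u v \<in> {0, 1}" and b_sym: "b i u v = b i v u" for i u v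
    by (auto simp: b_def insert_commute)
  have b_irr: "b i u u = 0" if "i \<in> I" for i u
    using FE[OF that, of "{u}"] E[of "{u}"] by (auto simp: b_def)
  have a01: "a u v \<in> {0, 1}" and a_sym: "a u v = a v u" for u v
    by (auto simp: a_iff insert_commute)
  have a_irr: "a u u = 0" for u
    by (simp add: a_def b_irr)
  define S3 :: "('a \<Rightarrow> 'a \<Rightarrow> 'a \<Rightarrow> real) \<Rightarrow> real" where
    "S3 h = (\<Sum>u\<in>V. \<Sum>v\<in>V. \<Sum>w\<in>V. h u v w)" for h
  have S3_mono: "S3 g \<le> S3 h" if "\<And>u v w. g u v w \<le> h u v w" for g h
    unfolding S3_def by (intro sum_mono that)
  have S3_swap: "S3 (\<lambda>u v w. h v u w) = S3 h" for h
    unfolding S3_def by (rule sum.swap)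
  have S3_swap': "S3 (\<lambda>u v w. h u w v) = S3 h" for h
    unfolding S3_def by (intro sum.cong refl sum.swap)
  \<comment> \<open>Monochromatic cherries with centre \<open>u\<close> whose ends are joined by a
    kept edge of any color.\<close>
  define cherry where "cherry u v w = (\<Sum>i\<in>I. b i u v * b i u w * a v w)" for u v w
  define C where "C i = (\<Sum>u\<in>V. \<Sum>v\<in>V. \<Sum>w\<in>V. b i u v * b i u w * a v w)" for i
  have cherry_nonneg: "cherry u v w \<ge> 0" for u v w
    using b01 a01 unfolding cherry_def a_iff b_def by (intro sum_nonneg) auto
  have cherry_eq_1: "cherry u v w \<ge> 1" if "f {u, v} = f {u, w}" "a u v = 1" "a u w = 1" "a v w = 1" for u v w
  proof -
    have "1 \<le> b (f {u, v}) u v * b (f {u, v}) u w * a v w"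
      using that by (auto simp: a_iff b_def)
    also have "\<dots> \<le> cherry u v w"
      unfolding cherry_def
      by (rule member_le_sum) (use that I in \<open>auto simp: a_iff b_def\<close>)
    finally show ?thesis .
  qed
  \<comment> \<open>Two edges of a non-rainbow triangle share a color, and their common vertex is
    the centre of a closed cherry.\<close>
  have "a u v * a u w * a v w \<le> cherry u v w + cherry v u w + cherry w u v" for u v w
  proof (cases "a u v = 1 \<and> a u w = 1 \<and> a v w = 1")
    case True
    have inE: "{x, y} \<in> E" "x \<noteq> y" if "a x y = 1" for x y
    proof -
      show "{x, y} \<in> E"
        using that FE by (auto simp: a_iff)
      show "x \<noteq> y"
        using that a_irr by auto
    qed
    have "f {u, v} = f {u, w} \<or> f {v, u} = f {v, w} \<or> f {w, u} = f {w, v}"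
      using no_rainbow[unfolded not_ex, rule_format, of u v w] True inE[of u v] inE[of u w] inE[of v w]
      by (auto simp: rainbow_triangle_def triangle_def insert_commute)
    then have "cherry u v w \<ge> 1 \<or> cherry v u w \<ge> 1 \<or> cherry w u v \<ge> 1"
      using True cherry_eq_1 a_sym by metis
    then show ?thesis
      using True cherry_nonneg[of u v w] cherry_nonneg[of v u w] cherry_nonneg[of w u v] by auto
  next
    case False
    then have "a u v * a u w * a v w = 0"
      using a01 by fastforce
    then show ?thesis
      using cherry_nonneg[of u v w] cherry_nonneg[of v u w] cherry_nonneg[of w u v] by linarith
  qed
  then have "S3 (\<lambda>u v w. a u v * a u w * a v w) \<le> S3 (\<lambda>u v w. cherry u v w + cherry v u w + cherry w u v)"
    by (rule S3_mono)
  also have "\<dots> = S3 cherry + S3 (\<lambda>u v w. cherry v u w) + S3 (\<lambda>u v w. cherry w u v)"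
    by (simp add: S3_def sum.distrib)
  \<comment> \<open>Renaming the summation variables shows that the three choices of centre
    contribute equally.\<close>
  also have "\<dots> = 3 * S3 cherry"
    using S3_swap[of cherry] S3_swap'[of "\<lambda>u v w. cherry v u w"] by simp
  also have "S3 cherry = (\<Sum>i\<in>I. C i)"
  proof -
    have "S3 cherry = (\<Sum>u\<in>V. \<Sum>v\<in>V. \<Sum>i\<in>I. \<Sum>w\<in>V. b i u v * b i u w * a v w)"
      unfolding S3_def cherry_def by (intro sum.cong refl sum.swap)
    also have "\<dots> = (\<Sum>u\<in>V. \<Sum>i\<in>I. \<Sum>v\<in>V. \<Sum>w\<in>V. b i u v * b i u w * a v w)"
      by (intro sum.cong refl sum.swap)
    also have "\<dots> = (\<Sum>i\<in>I. C i)"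
      unfolding C_def by (rule sum.swap)
    finally show ?thesis .
  qed
  finally have T: "S3 (\<lambda>u v w. a u v * a u w * a v w) \<le> 3 * (\<Sum>i\<in>I. C i)" .
  have size: "(\<Sum>u\<in>V. \<Sum>v\<in>V. b i u v) = 2 * real k" if "i \<in> I" for i
  proof -
    have "finite (F i)"
      using FE[OF that] \<open>finite E\<close> by (meson finite_subset subsetI)
    then show ?thesis
      unfolding b_def using V FE[OF that] E F(2)[OF that]
      by (subst sum_adjacency_eq_twice_card) auto
  qed
  have "(\<Sum>u\<in>V. \<Sum>v\<in>V. a u v) = (\<Sum>u\<in>V. \<Sum>i\<in>I. \<Sum>v\<in>V. b i u v)"
    unfolding a_def by (intro sum.cong refl sum.swap)
  also have "\<dots> = (\<Sum>i\<in>I. \<Sum>u\<in>V. \<Sum>v\<in>V. b i u v)"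
    by (rule sum.swap)
  finally have sum_a: "(\<Sum>u\<in>V. \<Sum>v\<in>V. a u v) = 2 * real k * real n"
    using I by (simp add: size)
  \<comment> \<open>As \<open>2 * k\<close> is the average degree, the sum of squared degrees is 4
    k^2 n plus the squared deviations. Substituting this into the triangle identity leaves exactly
    \<open>W\<close> beyond the main term.\<close>
  define W where "W = 2 * (\<Sum>u\<in>V. ((\<Sum>v\<in>V. a u v) - 2 * real k)\<^sup>2)
    + S3 (\<lambda>u v w. a u v * (1 - a u w) * (1 - a v w))"
  have "(\<Sum>u\<in>V. ((\<Sum>v\<in>V. a u v) - 2 * real k)\<^sup>2) =
      (\<Sum>u\<in>V. (\<Sum>v\<in>V. a u v)\<^sup>2 - 4 * real k * (\<Sum>v\<in>V. a u v) + 4 * (real k)\<^sup>2)"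
    by (simp add: power2_eq_square algebra_simps)
  also have "\<dots> =
      (\<Sum>u\<in>V. (\<Sum>v\<in>V. a u v)\<^sup>2) - 4 * real k * (\<Sum>u\<in>V. \<Sum>v\<in>V. a u v) + 4 * (real k)\<^sup>2 * real n"
    using assms(2) by (simp add: sum.distrib sum_subtractf sum_distrib_left)
  finally have "(\<Sum>u\<in>V. ((\<Sum>v\<in>V. a u v) - 2 * real k)\<^sup>2) =
      (\<Sum>u\<in>V. (\<Sum>v\<in>V. a u v)\<^sup>2) - 4 * real k * (\<Sum>u\<in>V. \<Sum>v\<in>V. a u v) + 4 * (real k)\<^sup>2 * real n" .
  moreover have "S3 (\<lambda>u v w. a u v * (1 - a u w) * (1 - a v w)) = S3 (\<lambda>u v w. a u v * a u w * a v w)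
      - 2 * (\<Sum>u\<in>V. (\<Sum>v\<in>V. a u v)\<^sup>2) + real n * (\<Sum>u\<in>V. \<Sum>v\<in>V. a u v)"
    using sum_induced_edge_isolated_vertex[of a V, OF a_sym] assms(2) by (simp add: S3_def)
  ultimately have "real n * (8 * (real k)\<^sup>2 - 2 * real n * real k) + W = S3 (\<lambda>u v w. a u v * a u w * a v w)"
    unfolding W_def sum_a by (simp add: power2_eq_square algebra_simps)
  with T have total: "real n * (8 * (real k)\<^sup>2 - 2 * real n * real k) + W \<le> 3 * (\<Sum>i\<in>I. C i)"
    by simp
  have "I \<noteq> {}"
    using I assms(3) by auto
  \<comment> \<open>A color with the most closed cherries has at least the average number, so the
    total bound passes to this single color class.\<close>
  then obtain j where j: "j \<in> I" "\<And>i. i \<in> I \<Longrightarrow> C i \<le> C j"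
    using I Max_in[of "C ` I"] by (metis (no_types, lifting) Max_ge empty_is_image finite_imageI image_iff)
  have "(\<Sum>i\<in>I. C i) \<le> real n * C j"
    using sum_bounded_above[of I C "C j"] j I by simp
  with total have avg: "real n * (8 * (real k)\<^sup>2 - 2 * real n * real k) + W \<le> 3 * real n * C j"
    by simp
  have a1: "a u v \<le> 1" for u v
    using a01[of u v] by auto
  obtain A where A: "A \<subseteq> V" "real (card A) \<le> real k" "C j \<le> 2 * real k * (real (card A) - 1)"
    "C j \<le> (\<Sum>u\<in>A. \<Sum>v\<in>A. a u v) + 2 * (real k - real (card A))\<^sup>2 + 2 * (real k - real (card A))"
    using closed_cherries_le_near_star[OF V b01 b_sym b_irr[OF j(1)] a1 a_irr size[OF j(1)] C_def] by metis
  define M where "M = (real (card A))\<^sup>2 - (\<Sum>u\<in>A. \<Sum>v\<in>A. a u v)"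
  have finA: "finite A"
    using A V finite_subset by blast
  \<comment> \<open>The diagonal pairs of \<open>A\<close> are never adjacent, so they alone
    contribute \<open>card A\<close> to \<open>M\<close>.\<close>
  have "(\<Sum>u\<in>A. \<Sum>v\<in>A. a u v) \<le> (\<Sum>u\<in>A. \<Sum>v\<in>A. 1 - of_bool (v = u))"
    using a1 a_irr by (intro sum_mono) auto
  also have "\<dots> = (real (card A))\<^sup>2 - real (card A)"
    using finA by (simp add: sum_subtractf of_bool_def power2_eq_square algebra_simps)
  finally have M_ge: "M \<ge> real (card A)"
    by (simp add: M_def)
  \<comment> \<open>The choice \<mu> = n / 10 is nearly optimal: with card A about 0.4 n, the gain
    is about 2 \<mu> * 0.078 n^2 and the quadratic cost about 0.8 \<mu>^2 n.\<close>
  have "2 * (real n / 10) * (real (card A) * real n - M - real (card A) * (2 * real k))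
      - (real n / 10)\<^sup>2 * real (card A) / 2 - (real n - real (card A)) * ((real n / 10)\<^sup>2 + M) \<le> W"
    unfolding W_def S3_def
    by (rule sum_induced_edge_isolated_vertex_ge) (use V A a01 a_sym assms(2) in \<open>auto simp: M_def\<close>)
  moreover have "W \<ge> 0"
  proof -
    have "a u v * (1 - a u w) * (1 - a v w) \<ge> 0" for u v w
      using a01[of u v] a01[of u w] a01[of v w] by auto
    then show ?thesis
      unfolding W_def S3_def by (intro add_nonneg_nonneg sum_nonneg mult_nonneg_nonneg[of 2]) auto
  qed
  moreover have "real k \<ge> 0.3988 * real n"
    by (simp add: k_def real_nat_ceiling_ge)
  ultimately show False
    using near_star_parameters_contradiction[of "real n" "real k" "real (card A)" M W "C j"]
      A M_ge avg assms(3) by (simp add: M_def)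
qed

end
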